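(* The equality $\mathcal{T}_{Lie}(B)=\mathcal{N}_{Lie}(B)$ is not true in each of the following cases: (i) $B=\mathbb{C}[x_1,x_2]$, the algebra of polynomials in two variables; (ii) $B=\mathbb{C}[x,x^{-1}]$, the algebra of Laurent polynomials in one variable; (iii) $B=\mathbb{C}(x)$, the algebra of rational functions of one variable.
   Context: For a unital associative algebra $B$, $B^{op}$ denotes the opposite algebra (same linear space, product $a*b=ba$), and $B\otimes B^{op}$ is the algebraic tensor product algebra. $\mathcal{T}_{Lie}(B)$ is the subalgebra (not required to contain the unit) of $B\otimes B^{op}$ generated by all elements $a\otimes 1-1\otimes a$, $a\in B$. $\mathcal{N}_{Lie}(B)$ is the subalgebra of $B\otimes B^{op}$ consisting of all tensors $\sum_k a_k\otimes b_k$ (finite sums) such that $\sum_k a_kb_k=0$ and $\sum_k b_ka_k=0$, the products being taken in $B$. *)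

theory Defs
  imports
    Complex_Main
    "HOL-Library.Poly_Mapping"
    "HOL-Library.Product_Plus"
    "HOL-Computational_Algebra.Polynomial"
    "HOL-Computational_Algebra.Fraction_Field"
begin

section \<open>Complex vector spaces and algebras\<close>

class scaleC =
  fixes scaleC :: "complex \<Rightarrow> 'a \<Rightarrow> 'a"  (infixr \<open>*\<^sub>C\<close> 75)

class complex_vector = scaleC + ab_group_add +
  assumes scaleC_add_right: "c *\<^sub>C (x + y) = c *\<^sub>C x + c *\<^sub>C y"
    and scaleC_add_left: "(c + d) *\<^sub>C x = c *\<^sub>C x + d *\<^sub>C x"
    and scaleC_scaleC: "c *\<^sub>C (d *\<^sub>C x) = (c * d) *\<^sub>C x"
    and scaleC_one: "1 *\<^sub>C x = x"

class complex_algebra = complex_vector + ring +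
  assumes mult_scaleC_left: "(c *\<^sub>C x) * y = c *\<^sub>C (x * y)"
    and mult_scaleC_right: "x * (c *\<^sub>C y) = c *\<^sub>C (x * y)"

class complex_algebra_1 = complex_algebra + ring_1

global_interpretation complex_vector: vector_space "scaleC :: complex \<Rightarrow> 'a \<Rightarrow> 'a::complex_vector"
  by unfold_locales (auto simp: scaleC_add_right scaleC_add_left scaleC_scaleC scaleC_one)

definition complex_subalgebra :: "'a::complex_algebra set \<Rightarrow> bool" where
  "complex_subalgebra S \<longleftrightarrow> complex_vector.subspace S \<and> (\<forall>x\<in>S. \<forall>y\<in>S. x * y \<in> S)"


section \<open>The algebras of the examples\<close>

instantiation complex :: complex_algebra_1
begin

definition scaleC_complex :: "complex \<Rightarrow> complex \<Rightarrow> complex" where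
  "scaleC_complex c x = c * x"

instance
  by standard (auto simp: scaleC_complex_def algebra_simps)

end

instantiation poly_mapping :: (type, complex_vector) complex_vector
begin

definition scaleC_poly_mapping :: "complex \<Rightarrow> ('a \<Rightarrow>\<^sub>0 'b) \<Rightarrow> ('a \<Rightarrow>\<^sub>0 'b)" where
  "scaleC_poly_mapping c f = Poly_Mapping.map (scaleC c) f"

lemma lookup_scaleC: "Poly_Mapping.lookup (c *\<^sub>C (f :: 'a \<Rightarrow>\<^sub>0 'b)) k = c *\<^sub>C Poly_Mapping.lookup f k"
  by (auto simp: scaleC_poly_mapping_def map.rep_eq when_def)

instance
  by standard (auto intro!: poly_mapping_eqI simp: lookup_scaleC lookup_add
      scaleC_add_right scaleC_add_left scaleC_scaleC scaleC_one)

end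

lemma scaleC_single: "c *\<^sub>C Poly_Mapping.single k x = Poly_Mapping.single k (c *\<^sub>C x)"
  by (rule poly_mapping_eqI) (auto simp: lookup_scaleC lookup_single when_def)

lemma poly_mapping_add_induct [case_names zero single add]:
  fixes p :: "'a \<Rightarrow>\<^sub>0 'b::comm_monoid_add"
  assumes "P 0" "\<And>k x. P (Poly_Mapping.single k x)" "\<And>p q. P p \<Longrightarrow> P q \<Longrightarrow> P (p + q)"
  shows "P p"
proof (induction p rule: update_induct)
  case const
  then show ?case by (rule assms)
next
  case (update f a b)
  have "Poly_Mapping.update a b f = f + Poly_Mapping.single a b"
    using update by (intro poly_mapping_eqI)
      (auto simp: lookup_update lookup_add lookup_single when_def in_keys_iff)
  then show ?case using assms update by simp
qed

instance poly_mapping :: (monoid_add, complex_algebra) complex_algebra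
proof
  fix c and x y :: "'a \<Rightarrow>\<^sub>0 'b"
  show "(c *\<^sub>C x) * y = c *\<^sub>C (x * y)"
  proof (induction x rule: poly_mapping_add_induct)
    case (single k a)
    show ?case
      by (induction y rule: poly_mapping_add_induct)
        (auto simp: scaleC_single mult_single mult_scaleC_left scaleC_add_right distrib_left)
  qed (auto simp: scaleC_add_right distrib_right)
  show "x * (c *\<^sub>C y) = c *\<^sub>C (x * y)"
  proof (induction x rule: poly_mapping_add_induct)
    case (single k a)
    show ?case
      by (induction y rule: poly_mapping_add_induct)
        (auto simp: scaleC_single mult_single mult_scaleC_right scaleC_add_right distrib_left)
  qed (auto simp: scaleC_add_right distrib_right)
qed

instance poly_mapping :: (monoid_add, complex_algebra_1) complex_algebra_1 ..

instantiation poly :: ("{comm_ring_1, complex_algebra_1}") complex_algebra_1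
begin

definition scaleC_poly :: "complex \<Rightarrow> 'a poly \<Rightarrow> 'a poly" where
  "scaleC_poly c p = smult (c *\<^sub>C 1) p"

instance
  by standard (auto simp: scaleC_poly_def smult_add_right scaleC_add_left smult_add_left
      scaleC_scaleC scaleC_one mult_scaleC_left)

end

instantiation fract :: ("{idom, complex_algebra_1}") complex_algebra_1
begin

definition scaleC_fract :: "complex \<Rightarrow> 'a fract \<Rightarrow> 'a fract" where
  "scaleC_fract c q = Fract (c *\<^sub>C 1) 1 * q"

instance
proof
  fix c d and x y :: "'a fract"
  show "c *\<^sub>C (x + y) = c *\<^sub>C x + c *\<^sub>C y"
    by (simp add: scaleC_fract_def distrib_left)
  have "Fract ((c + d) *\<^sub>C 1) 1 = Fract (c *\<^sub>C 1) 1 + Fract (d *\<^sub>C (1::'a)) 1"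
    by (simp add: scaleC_add_left)
  then show "(c + d) *\<^sub>C x = c *\<^sub>C x + d *\<^sub>C x"
    unfolding scaleC_fract_def by (simp only: distrib_right)
  have "Fract ((c * d) *\<^sub>C 1) 1 = Fract (c *\<^sub>C 1) 1 * Fract (d *\<^sub>C (1::'a)) 1"
    by (simp add: mult_scaleC_left scaleC_scaleC)
  then show "c *\<^sub>C (d *\<^sub>C x) = (c * d) *\<^sub>C x"
    unfolding scaleC_fract_def by (simp only: mult.assoc)
  show "1 *\<^sub>C x = x"
    by (simp add: scaleC_fract_def scaleC_one flip: One_fract_def)
  show "(c *\<^sub>C x) * y = c *\<^sub>C (x * y)" "x * (c *\<^sub>C y) = c *\<^sub>C (x * y)"
    by (simp_all add: scaleC_fract_def mult_ac)
qed

end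

text \<open>
  \<open>(nat \<times> nat) \<Rightarrow>\<^sub>0 complex\<close> and \<open>int \<Rightarrow>\<^sub>0 complex\<close> are the monoid algebras of the monoids
  of monomials \<open>x\<^sub>1\<^sup>i x\<^sub>2\<^sup>j\<close> and \<open>x\<^sup>n\<close> (\<open>n\<close> an integer): the keys are exponents, which
  are added under the (convolution) product.
\<close>

type_synonym poly_two_vars = "(nat \<times> nat) \<Rightarrow>\<^sub>0 complex"
type_synonym laurent_poly = "int \<Rightarrow>\<^sub>0 complex"
type_synonym rational_function = "complex poly fract"


section \<open>The opposite algebra\<close>

datatype 'a opposite = Op (unop: 'a)

instantiation opposite :: (complex_algebra) complex_algebra
begin

definition "0 = Op 0"
definition "x + y = Op (unop x + unop y)"
definition "x - y = Op (unop x - unop y)"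
definition "- x = Op (- unop x)"
definition "c *\<^sub>C x = Op (c *\<^sub>C unop x)"
definition "x * y = Op (unop y * unop x)"

lemmas opposite_defs = zero_opposite_def plus_opposite_def minus_opposite_def
  uminus_opposite_def scaleC_opposite_def times_opposite_def

instance
  by standard (auto simp: opposite_defs opposite.expand algebra_simps scaleC_add_right scaleC_add_left
      scaleC_scaleC scaleC_one mult_scaleC_left mult_scaleC_right)

end

instantiation opposite :: (complex_algebra_1) complex_algebra_1
begin

definition "1 = Op 1"

instance
  by standard (auto simp: opposite_defs one_opposite_def)

end


section \<open>The tensor product\<close>

text \<open>
  The tensor product over the complex numbers is the free vector space on pairs modulo the
  subspace spanned by the relations that make \<open>(a, b) \<mapsto> a \<otimes> b\<close> bilinear.
\<close>

abbreviation free_pair :: "'a \<Rightarrow> 'b \<Rightarrow> ('a \<times> 'b) \<Rightarrow>\<^sub>0 complex" where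
  "free_pair a b \<equiv> Poly_Mapping.single (a, b) 1"

inductive_set bilinear_relations :: "(('a::complex_vector \<times> 'b::complex_vector) \<Rightarrow>\<^sub>0 complex) set" where
  add_left: "free_pair (a + a') b - free_pair a b - free_pair a' b \<in> bilinear_relations"
| add_right: "free_pair a (b + b') - free_pair a b - free_pair a b' \<in> bilinear_relations"
| scale_left: "free_pair (c *\<^sub>C a) b - c *\<^sub>C free_pair a b \<in> bilinear_relations"
| scale_right: "free_pair a (c *\<^sub>C b) - c *\<^sub>C free_pair a b \<in> bilinear_relations"

definition tensor_rel ::
  "(('a::complex_vector \<times> 'b::complex_vector) \<Rightarrow>\<^sub>0 complex) \<Rightarrow> (('a \<times> 'b) \<Rightarrow>\<^sub>0 complex) \<Rightarrow> bool" where
  "tensor_rel f g \<longleftrightarrow> f - g \<in> complex_vector.span bilinear_relations"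

lemma equivp_tensor_rel: "equivp tensor_rel"
proof (rule equivpI)
  show "reflp tensor_rel"
    by (auto simp: reflp_def tensor_rel_def complex_vector.span_zero)
  show "symp tensor_rel"
    unfolding symp_def tensor_rel_def by (auto dest: complex_vector.span_neg)
  show "transp tensor_rel"
    unfolding transp_def tensor_rel_def by (auto dest: complex_vector.span_add)
qed

quotient_type (overloaded) ('a, 'b) tensor =
    "('a::complex_vector \<times> 'b::complex_vector) \<Rightarrow>\<^sub>0 complex" / tensor_rel
  by (rule equivp_tensor_rel)

lift_definition pure_tensor :: "'a::complex_vector \<Rightarrow> 'b::complex_vector \<Rightarrow> ('a, 'b) tensor"
  (infixr \<open>\<otimes>\<close> 75) is free_pair .

instantiation tensor :: (complex_vector, complex_vector) complex_vector
begin

lift_definition zero_tensor :: "('a, 'b) tensor" is 0 .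

lift_definition plus_tensor :: "('a, 'b) tensor \<Rightarrow> ('a, 'b) tensor \<Rightarrow> ('a, 'b) tensor" is "(+)"
  unfolding tensor_rel_def by (drule (1) complex_vector.span_add) (simp add: add_diff_add)

lift_definition minus_tensor :: "('a, 'b) tensor \<Rightarrow> ('a, 'b) tensor \<Rightarrow> ('a, 'b) tensor" is "(-)"
  unfolding tensor_rel_def by (drule (1) complex_vector.span_diff) (simp add: algebra_simps)

lift_definition uminus_tensor :: "('a, 'b) tensor \<Rightarrow> ('a, 'b) tensor" is uminus
  unfolding tensor_rel_def by (drule complex_vector.span_neg) (simp add: algebra_simps)

lift_definition scaleC_tensor :: "complex \<Rightarrow> ('a, 'b) tensor \<Rightarrow> ('a, 'b) tensor" is scaleC
  unfolding tensor_rel_def complex_vector.scale_right_diff_distrib[symmetric]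
  by (rule complex_vector.span_scale)

instance
  by standard
    (transfer; simp add: algebra_simps tensor_rel_def complex_vector.span_zero scaleC_add_right
      scaleC_add_left scaleC_scaleC scaleC_one)+

end

lemma tensor_add_left: "(a + a') \<otimes> b = a \<otimes> b + a' \<otimes> b"
  by transfer (use complex_vector.span_base[OF bilinear_relations.add_left] in
      \<open>simp add: tensor_rel_def diff_diff_eq\<close>)

lemma tensor_add_right: "a \<otimes> (b + b') = a \<otimes> b + a \<otimes> b'"
  by transfer (use complex_vector.span_base[OF bilinear_relations.add_right] in
      \<open>simp add: tensor_rel_def diff_diff_eq\<close>)

lemma tensor_scaleC_left: "(c *\<^sub>C a) \<otimes> b = c *\<^sub>C (a \<otimes> b)"
  by transfer (use complex_vector.span_base[OF bilinear_relations.scale_left] in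
      \<open>simp add: tensor_rel_def\<close>)

lemma tensor_scaleC_right: "a \<otimes> (c *\<^sub>C b) = c *\<^sub>C (a \<otimes> b)"
  by transfer (use complex_vector.span_base[OF bilinear_relations.scale_right] in
      \<open>simp add: tensor_rel_def\<close>)

lemma tensor_induct [case_names pure add]:
  fixes t :: "('a::complex_vector, 'b::complex_vector) tensor"
  assumes pure: "\<And>a b. P (a \<otimes> b)" and add: "\<And>s t. P s \<Longrightarrow> P t \<Longrightarrow> P (s + t)"
  shows "P t"
proof -
  have "P (abs_tensor f)" for f :: "('a \<times> 'b) \<Rightarrow>\<^sub>0 complex"
  proof (induction f rule: poly_mapping_add_induct)
    case zero
    have "abs_tensor 0 = 0 *\<^sub>C ((0::'a) \<otimes> (0::'b))"
      by (simp add: zero_tensor_def)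
    then show ?case using pure by (simp flip: tensor_scaleC_left)
  next
    case (single k x)
    have "abs_tensor (Poly_Mapping.single k x) = x *\<^sub>C (fst k \<otimes> snd k)"
      by (simp add: pure_tensor.abs_eq scaleC_tensor.abs_eq scaleC_single scaleC_complex_def)
    then show ?case using pure by (simp flip: tensor_scaleC_left)
  next
    case (add f g)
    then show ?case using assms(2) by (simp flip: plus_tensor.abs_eq)
  qed
  then show ?thesis by (metis Quotient3_tensor Quotient3_abs_rep)
qed


subsection \<open>Linear extension\<close>

definition free_lift :: "('k \<Rightarrow> 'v::complex_vector) \<Rightarrow> ('k \<Rightarrow>\<^sub>0 complex) \<Rightarrow> 'v" where
  "free_lift h f = (\<Sum>k\<in>Poly_Mapping.keys f. Poly_Mapping.lookup f k *\<^sub>C h k)"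

lemma free_lift_superset:
  assumes "finite S" "Poly_Mapping.keys f \<subseteq> S"
  shows "free_lift h f = (\<Sum>k\<in>S. Poly_Mapping.lookup f k *\<^sub>C h k)"
  unfolding free_lift_def using assms
  by (intro sum.mono_neutral_left) (auto simp: in_keys_iff)

lemma free_lift_zero [simp]: "free_lift h 0 = 0"
  by (simp add: free_lift_def)

lemma free_lift_single [simp]: "free_lift h (Poly_Mapping.single k c) = c *\<^sub>C h k"
  by (simp add: free_lift_def)

lemma free_lift_add: "free_lift h (f + g) = free_lift h f + free_lift h g"
  using free_lift_superset[of "Poly_Mapping.keys f \<union> Poly_Mapping.keys g" f h]
    free_lift_superset[of "Poly_Mapping.keys f \<union> Poly_Mapping.keys g" g h]
    free_lift_superset[of "Poly_Mapping.keys f \<union> Poly_Mapping.keys g" "f + g" h] Poly_Mapping.keys_add[of f g]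
  by (simp add: lookup_add scaleC_add_left sum.distrib)

lemma free_lift_scaleC: "free_lift h (c *\<^sub>C f) = c *\<^sub>C free_lift h f"
proof -
  have "Poly_Mapping.keys (c *\<^sub>C f) \<subseteq> Poly_Mapping.keys f"
    by (auto simp: in_keys_iff lookup_scaleC)
  then show ?thesis
    using free_lift_superset[of "Poly_Mapping.keys f" "c *\<^sub>C f" h]
    by (simp add: free_lift_def lookup_scaleC complex_vector.scale_sum_right
        scaleC_complex_def scaleC_scaleC)
qed

lemma free_lift_diff: "free_lift h (f - g) = free_lift h f - free_lift h g"
  using free_lift_add[of h "f - g" g] by (simp add: algebra_simps)

lemma free_lift_fun_add: "free_lift (\<lambda>k. h k + h' k) f = free_lift h f + free_lift h' f"
  by (simp add: free_lift_def scaleC_add_right sum.distrib)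

lemma free_lift_fun_scaleC: "free_lift (\<lambda>k. c *\<^sub>C h k) f = c *\<^sub>C free_lift h f"
  by (simp add: free_lift_def complex_vector.scale_sum_right scaleC_scaleC mult.commute)

text \<open>The universal property: a bilinear map factors through the tensor product.\<close>

definition bilinearC :: "('a::complex_vector \<Rightarrow> 'b::complex_vector \<Rightarrow> 'v::complex_vector) \<Rightarrow> bool" where
  "bilinearC h \<longleftrightarrow>
     (\<forall>a a' b. h (a + a') b = h a b + h a' b) \<and> (\<forall>a b b'. h a (b + b') = h a b + h a b') \<and>
     (\<forall>c a b. h (c *\<^sub>C a) b = c *\<^sub>C h a b) \<and> (\<forall>c a b. h a (c *\<^sub>C b) = c *\<^sub>C h a b)"

definition tensor_lift ::
    "('a::complex_vector \<Rightarrow> 'b::complex_vector \<Rightarrow> 'v::complex_vector) \<Rightarrow> ('a, 'b) tensor \<Rightarrow> 'v" where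
  "tensor_lift h t = free_lift (\<lambda>(a, b). h a b) (rep_tensor t)"

lemma free_lift_bilinear_relations:
  assumes "bilinearC h" "f \<in> complex_vector.span bilinear_relations"
  shows "free_lift (\<lambda>(a, b). h a b) f = 0"
  using assms(2)
proof (induction rule: complex_vector.span_induct)
  case base
  show ?case
    by (auto simp: complex_vector.subspace_def free_lift_add free_lift_scaleC)
next
  case (step x)
  then show ?case
    using assms(1) by cases (auto simp: bilinearC_def free_lift_diff free_lift_scaleC scaleC_one)
qed

lemma tensor_lift_abs:
  assumes "bilinearC h"
  shows "tensor_lift h (abs_tensor f) = free_lift (\<lambda>(a, b). h a b) f"
proof -
  have "tensor_rel (rep_tensor (abs_tensor f)) f"
    by (rule Quotient3_rep_abs[OF Quotient3_tensor]) (simp add: tensor_rel_def complex_vector.span_zero)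
  then show ?thesis
    using free_lift_bilinear_relations[OF assms, of "rep_tensor (abs_tensor f) - f"]
    by (simp add: tensor_rel_def tensor_lift_def free_lift_diff)
qed

lemma tensor_lift_pure: "bilinearC h \<Longrightarrow> tensor_lift h (a \<otimes> b) = h a b"
  by (simp add: pure_tensor.abs_eq tensor_lift_abs scaleC_one)

lemma tensor_lift_add:
  assumes "bilinearC h"
  shows "tensor_lift h (s + t) = tensor_lift h s + tensor_lift h t"
proof -
  have "s = abs_tensor (rep_tensor s)" "t = abs_tensor (rep_tensor t)"
    by (simp_all add: Quotient3_abs_rep[OF Quotient3_tensor])
  then show ?thesis
    using assms by (metis plus_tensor.abs_eq tensor_lift_abs free_lift_add)
qed

lemma tensor_lift_scaleC:
  assumes "bilinearC h"
  shows "tensor_lift h (c *\<^sub>C t) = c *\<^sub>C tensor_lift h t"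
proof -
  have "t = abs_tensor (rep_tensor t)"
    by (simp add: Quotient3_abs_rep[OF Quotient3_tensor])
  then show ?thesis
    using assms by (metis scaleC_tensor.abs_eq tensor_lift_abs free_lift_scaleC)
qed

lemma tensor_lift_fun_add:
  "tensor_lift (\<lambda>a b. h a b + h' a b) t = tensor_lift h t + tensor_lift h' t"
  by (simp add: tensor_lift_def case_prod_unfold free_lift_fun_add)

lemma tensor_lift_fun_scaleC:
  "tensor_lift (\<lambda>a b. c *\<^sub>C h a b) t = c *\<^sub>C tensor_lift h t"
  by (simp add: tensor_lift_def case_prod_unfold free_lift_fun_scaleC)


subsection \<open>The tensor product algebra\<close>

text \<open>The product is the bilinear extension of \<open>(a \<otimes> b) * (c \<otimes> d) = (a * c) \<otimes> (b * d)\<close>;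
  see \<open>tensor_mult_pure\<close> below.\<close>

instantiation tensor :: (complex_algebra, complex_algebra) complex_algebra
begin

definition times_tensor :: "('a, 'b) tensor \<Rightarrow> ('a, 'b) tensor \<Rightarrow> ('a, 'b) tensor" where
  "s * t = tensor_lift (\<lambda>a b. tensor_lift (\<lambda>c d. (a * c) \<otimes> (b * d)) t) s"

lemma tensor_mult_bilinear_inner:
  "bilinearC (\<lambda>c d. ((a::'a) * c) \<otimes> ((b::'b) * d))"
  by (simp add: bilinearC_def distrib_left tensor_add_left tensor_add_right mult_scaleC_right
      tensor_scaleC_left tensor_scaleC_right)

lemma tensor_mult_bilinear_outer:
  "bilinearC (\<lambda>(a::'a) (b::'b). tensor_lift (\<lambda>c d. (a * c) \<otimes> (b * d)) t)"
  by (simp add: bilinearC_def distrib_right tensor_add_left tensor_add_right mult_scaleC_left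
      tensor_scaleC_left tensor_scaleC_right tensor_lift_fun_add tensor_lift_fun_scaleC)

lemma tensor_mult_pure: "((a::'a) \<otimes> (b::'b)) * (c \<otimes> d) = (a * c) \<otimes> (b * d)"
  unfolding times_tensor_def tensor_lift_pure[OF tensor_mult_bilinear_outer]
  by (rule tensor_lift_pure[OF tensor_mult_bilinear_inner])

lemma tensor_mult_add_left: "((s::('a, 'b) tensor) + t) * u = s * u + t * u"
  by (simp add: times_tensor_def tensor_lift_add tensor_mult_bilinear_outer)

lemma tensor_mult_add_right: "(u::('a, 'b) tensor) * (s + t) = u * s + u * t"
  by (simp add: times_tensor_def tensor_lift_add[OF tensor_mult_bilinear_inner]
      tensor_lift_fun_add)

instance
proof
  fix s t u :: "('a, 'b) tensor" and c :: complex
  show "(s + t) * u = s * u + t * u" "u * (s + t) = u * s + u * t"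
    by (rule tensor_mult_add_left tensor_mult_add_right)+
  show "(c *\<^sub>C s) * t = c *\<^sub>C (s * t)"
    by (simp add: times_tensor_def tensor_lift_scaleC tensor_mult_bilinear_outer)
  show "s * (c *\<^sub>C t) = c *\<^sub>C (s * t)"
    by (simp add: times_tensor_def tensor_lift_scaleC[OF tensor_mult_bilinear_inner]
        tensor_lift_fun_scaleC)
  show "s * t * u = s * (t * u)"
  proof (induction s rule: tensor_induct)
    case (pure a b)
    show ?case
    proof (induction t rule: tensor_induct)
      case (pure a' b')
      show ?case
        by (induction u rule: tensor_induct)
          (simp_all add: tensor_mult_pure tensor_mult_add_right mult.assoc)
    qed (simp add: tensor_mult_add_left tensor_mult_add_right)
  qed (simp add: tensor_mult_add_left)
qed

end


section \<open>The two subalgebras\<close>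

definition T_Lie :: "'b::complex_algebra_1 itself \<Rightarrow> ('b, 'b opposite) tensor set" where
  "T_Lie (_ :: 'b itself) = complex_subalgebra hull {a \<otimes> 1 - 1 \<otimes> Op a | a :: 'b. True}"

definition N_Lie :: "'b::complex_algebra_1 itself \<Rightarrow> ('b, 'b opposite) tensor set" where
  "N_Lie (_ :: 'b itself) = {(\<Sum>k<n. a k \<otimes> Op (b k)) | (n::nat) (a :: nat \<Rightarrow> 'b) (b :: nat \<Rightarrow> 'b).
      (\<Sum>k<n. a k * b k) = 0 \<and> (\<Sum>k<n. b k * a k) = 0}"

end

theory Submission
  imports Defs
begin

text \<open>
  For commutative \<open>B\<close> the elements of \<open>N_Lie B\<close> form the kernel of the multiplication
  \<open>a \<otimes> b \<mapsto> a b\<close>. A derivation \<open>\<delta>\<close> of \<open>B\<close> induces \<open>D (a \<otimes> b) = a \<delta>(b)\<close>, which vanishes on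
  products of two elements of this kernel and sends \<open>a \<otimes> 1 - 1 \<otimes> a\<close> to \<open>- \<delta>(a)\<close>; so \<open>D\<close> maps
  \<open>T_Lie B\<close> into the range of \<open>\<delta>\<close>. On the other hand \<open>a \<otimes> b - a b \<otimes> 1\<close> is mapped to \<open>a \<delta>(b)\<close>,
  and it suffices to make this fall outside the range of \<open>\<delta>\<close>. Suitable choices are
  \<open>\<delta> = x\<^sub>1 \<partial>\<^sub>1 - x\<^sub>2 \<partial>\<^sub>2\<close>, \<open>a = x\<^sub>1\<close>, \<open>b = x\<^sub>2\<close> for polynomials, \<open>\<delta> = x d/dx\<close>, \<open>a = x\<^sup>-\<^sup>1\<close>, \<open>b = x\<close>
  for Laurent polynomials, and \<open>\<delta> = d/dx\<close>, \<open>a = x\<^sup>-\<^sup>1\<close>, \<open>b = x\<close> for rational functions.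
\<close>

section \<open>Derivations of a commutative algebra and the maps they induce on the tensor
  product\<close>

locale complex_derivation =
  fixes \<delta> :: "'b::{comm_ring_1, complex_algebra_1} \<Rightarrow> 'b"
  assumes add: "\<delta> (a + b) = \<delta> a + \<delta> b"
    and scaleC: "\<delta> (c *\<^sub>C a) = c *\<^sub>C \<delta> a"
    and leibniz: "\<delta> (a * b) = a * \<delta> b + b * \<delta> a"
begin

lemma one [simp]: "\<delta> 1 = 0"
  using leibniz[of 1 1] by simp

lemma subspace_range: "complex_vector.subspace (range \<delta>)"
proof -
  have "\<delta> 0 = 0"
    using add[of 0 0] by simp
  then have "0 \<in> range \<delta>"
    by (metis rangeI)
  then show ?thesis
    by (auto simp: complex_vector.subspace_def simp flip: add scaleC)
qed

definition mult_map :: "('b, 'b opposite) tensor \<Rightarrow> 'b" where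
  "mult_map = tensor_lift (\<lambda>a b. a * unop b)"

text \<open>With \<open>I\<close> the kernel of \<open>mult_map\<close>, the restriction to
  \<open>I\<close> evaluates the class of a tensor in \<open>I/I^2\<close>, the Kaehler
  differentials, at \<open>\<delta>\<close>.\<close>

definition form_map :: "('b, 'b opposite) tensor \<Rightarrow> 'b" where
  "form_map = tensor_lift (\<lambda>a b. a * \<delta> (unop b))"

lemma bilinearC_mult: "bilinearC (\<lambda>a b. a * unop b :: 'b)"
  by (simp add: bilinearC_def opposite_defs algebra_simps mult_scaleC_left mult_scaleC_right)

lemma bilinearC_form: "bilinearC (\<lambda>a b. a * \<delta> (unop b))"
  by (simp add: bilinearC_def opposite_defs algebra_simps mult_scaleC_left mult_scaleC_right
      add scaleC)

lemma mult_map_simps [simp]: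
  "mult_map (a \<otimes> b) = a * unop b"
  "mult_map (s + t) = mult_map s + mult_map t"
  "mult_map (c *\<^sub>C t) = c *\<^sub>C mult_map t"
  by (simp_all add: mult_map_def bilinearC_mult tensor_lift_pure tensor_lift_add tensor_lift_scaleC)

lemma form_map_simps [simp]:
  "form_map (a \<otimes> b) = a * \<delta> (unop b)"
  "form_map (s + t) = form_map s + form_map t"
  "form_map (c *\<^sub>C t) = c *\<^sub>C form_map t"
  by (simp_all add: form_map_def bilinearC_form tensor_lift_pure tensor_lift_add tensor_lift_scaleC)

lemma mult_map_diff [simp]: "mult_map (s - t) = mult_map s - mult_map t"
  using mult_map_simps(2)[of "s - t" t] by (simp del: mult_map_simps)

lemma form_map_diff [simp]: "form_map (s - t) = form_map s - form_map t"
  using form_map_simps(2)[of "s - t" t] by (simp del: form_map_simps)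

lemma mult_map_zero [simp]: "mult_map 0 = 0"
  using mult_map_simps(2)[of 0 0] by (simp del: mult_map_simps)

lemma form_map_zero [simp]: "form_map 0 = 0"
  using form_map_simps(2)[of 0 0] by (simp del: form_map_simps)

lemma mult_map_mult: "mult_map (s * t) = mult_map s * mult_map t"
proof (induction s rule: tensor_induct)
  case (pure a b)
  show ?case
    by (induction t rule: tensor_induct)
      (simp_all add: tensor_mult_pure opposite_defs algebra_simps)
qed (simp add: algebra_simps)

text \<open>Both summands vanish on two factors in the kernel of \<open>mult_map\<close>. Hence
  closure under products in \<open>T_Lie_subset\<close> only needs 0 in
  \<open>range \<delta>\<close>, which need not be a subalgebra.\<close>

lemma form_map_mult: "form_map (s * t) = mult_map s * form_map t + mult_map t * form_map s"
proof (induction s rule: tensor_induct)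
  case (pure a b)
  show ?case
    by (induction t rule: tensor_induct)
      (simp_all add: tensor_mult_pure opposite_defs algebra_simps leibniz)
qed (simp add: algebra_simps)

lemma T_Lie_subset: "T_Lie TYPE('b) \<subseteq> {t. mult_map t = 0 \<and> form_map t \<in> range \<delta>}"
  unfolding T_Lie_def
proof (rule hull_minimal)
  \<comment> \<open>The value is \<open>- \<delta> a\<close>, since
    \<open>\<delta> 1 = 0\<close>.\<close>
  have "form_map (a \<otimes> 1 - 1 \<otimes> Op a) \<in> range \<delta>" for a
    using complex_vector.subspace_neg[OF subspace_range, of "\<delta> a"]
    by (simp add: one_opposite_def)
  then show "{a \<otimes> 1 - 1 \<otimes> Op a |a. True} \<subseteq> {t. mult_map t = 0 \<and> form_map t \<in> range \<delta>}"
    by (auto simp: one_opposite_def)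
  show "complex_subalgebra {t. mult_map t = 0 \<and> form_map t \<in> range \<delta>}"
    using complex_vector.subspace_0[OF subspace_range]
    by (auto simp: complex_subalgebra_def complex_vector.subspace_def mult_map_mult form_map_mult
        simp del: image_iff intro: complex_vector.subspace_add[OF subspace_range]
        complex_vector.subspace_scale[OF subspace_range])
qed

lemma T_Lie_neq_N_Lie:
  assumes "a * \<delta> b \<notin> range \<delta>"
  shows "T_Lie TYPE('b) \<noteq> N_Lie TYPE('b)"
proof
  assume eq: "T_Lie TYPE('b) = N_Lie TYPE('b)"
  define t where "t = a \<otimes> Op b + (- (a * b)) \<otimes> Op 1"
  define a' b' where "a' = (\<lambda>k::nat. if k = 0 then a else - (a * b))"
    and "b' = (\<lambda>k::nat. if k = 0 then b else 1)"
  have "t = (\<Sum>k<2. a' k \<otimes> Op (b' k))" "(\<Sum>k<2. a' k * b' k) = 0" "(\<Sum>k<2. b' k * a' k) = 0"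
    by (simp_all add: t_def a'_def b'_def numeral_2_eq_2 mult.commute)
  then have "t \<in> N_Lie TYPE('b)"
    unfolding N_Lie_def mem_Collect_eq by (intro exI conjI)
  then have "form_map t \<in> range \<delta>"
    using eq T_Lie_subset by blast
  then show False
    using assms by (simp add: t_def)
qed

end


section \<open>Monoid algebras\<close>

text \<open>For additive \<open>w\<close> this is an Euler-type derivation: the monomial with
  exponent \<open>k\<close> is an eigenvector with eigenvalue \<open>w k\<close>.\<close>

lift_definition weight_derivation ::
    "('k \<Rightarrow> complex) \<Rightarrow> ('k \<Rightarrow>\<^sub>0 complex) \<Rightarrow> ('k \<Rightarrow>\<^sub>0 complex)" is "\<lambda>w f k. w k * f k"
  by (rule finite_subset) auto

lemma weight_derivation_single:
  "weight_derivation w (Poly_Mapping.single k c) = Poly_Mapping.single k (w k * c)"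
  by (rule poly_mapping_eqI)
    (simp add: weight_derivation.rep_eq lookup_single when_def)

lemma weight_derivation_add:
  "weight_derivation w (f + g) = weight_derivation w f + weight_derivation w g"
  by (rule poly_mapping_eqI)
    (simp add: weight_derivation.rep_eq lookup_add algebra_simps)

lemma complex_derivation_weight:
  fixes w :: "'k::comm_monoid_add \<Rightarrow> complex"
  assumes w: "\<And>k l. w (k + l) = w k + w l"
  shows "complex_derivation (weight_derivation w)"
proof
  fix f g :: "'k \<Rightarrow>\<^sub>0 complex" and c
  show "weight_derivation w (f + g) = weight_derivation w f + weight_derivation w g"
    by (rule weight_derivation_add)
  show "weight_derivation w (c *\<^sub>C f) = c *\<^sub>C weight_derivation w f"
    by (rule poly_mapping_eqI)
      (simp add: weight_derivation.rep_eq lookup_scaleC scaleC_complex_def)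
  show "weight_derivation w (f * g) = f * weight_derivation w g + g * weight_derivation w f"
  proof (induction f rule: poly_mapping_add_induct)
    case zero
    show ?case using weight_derivation_add[of w 0 0] by simp
  next
    case (single k a)
    show ?case
    proof (induction g rule: poly_mapping_add_induct)
      case zero
      show ?case using weight_derivation_add[of w 0 0] by simp
    next
      case (single l b)
      show ?case
        by (simp add: mult_single weight_derivation_single w add.commute[of l k]
            flip: single_add) (simp add: algebra_simps)
    qed (simp add: algebra_simps weight_derivation_add)
  qed (simp add: algebra_simps weight_derivation_add)
qed

text \<open>Everything in the range has coefficient 0 at an exponent of weight 0, such as
  \<open>k + l\<close>, whereas \<open>a * \<delta> b\<close> for the monomials \<open>k\<close> and
  \<open>l\<close> has coefficient \<open>w l\<close> there.\<close>

lemma T_Lie_neq_N_Lie_monoid_algebra: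
  fixes w :: "'k::comm_monoid_add \<Rightarrow> complex"
  assumes w: "\<And>k l. w (k + l) = w k + w l" and "w (k + l) = 0" "w l \<noteq> 0"
  shows "T_Lie TYPE('k \<Rightarrow>\<^sub>0 complex) \<noteq> N_Lie TYPE('k \<Rightarrow>\<^sub>0 complex)"
proof -
  interpret complex_derivation "weight_derivation w"
    by (rule complex_derivation_weight) (rule w)
  have "Poly_Mapping.lookup (Poly_Mapping.single k 1 * weight_derivation w (Poly_Mapping.single l 1)) (k + l) \<noteq> 0"
    using assms by (simp add: weight_derivation_single mult_single lookup_single)
  moreover have "Poly_Mapping.lookup (weight_derivation w f) (k + l) = 0" for f
    using assms by (simp add: weight_derivation.rep_eq)
  ultimately show ?thesis
    by (intro T_Lie_neq_N_Lie) (auto dest!: arg_cong[where f = "\<lambda>f. Poly_Mapping.lookup f (k + l)"])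
qed


section \<open>Rational functions\<close>

lift_definition fract_deriv :: "rational_function \<Rightarrow> rational_function" is
  "\<lambda>x. (pderiv (fst x) * snd x - fst x * pderiv (snd x), snd x * snd x)"
proof -
  fix x y :: "complex poly \<times> complex poly"
  assume "fractrel x y"
  moreover define p q r s where "p = fst x" "q = snd x" "r = fst y" "s = snd y"
  ultimately have nz: "q \<noteq> 0" "s \<noteq> 0" and eq: "p * s = r * q"
    by auto
  have "pderiv (p * s) = pderiv (r * q)"
    by (simp add: eq)
  then have d: "pderiv p * s + p * pderiv s = pderiv r * q + r * pderiv q"
    by (simp add: pderiv_mult algebra_simps)
  \<comment> \<open>The cross-multiplied difference of the two quotient-rule values is a combination
    of the relation \<open>p * s = r * q\<close> and its derivative.\<close>
  have "(pderiv p * q - p * pderiv q) * (s * s) - (pderiv r * s - r * pderiv s) * (q * q)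
      = q * s * ((pderiv p * s + p * pderiv s) - (pderiv r * q + r * pderiv q))
        - (p * s - r * q) * (q * pderiv s + s * pderiv q)"
    by (simp add: algebra_simps)
  then show "fractrel (pderiv (fst x) * snd x - fst x * pderiv (snd x), snd x * snd x)
      (pderiv (fst y) * snd y - fst y * pderiv (snd y), snd y * snd y)"
    using nz d eq by (simp flip: p_q_r_s_def)
qed

lemma fract_deriv_Fract:
  "q \<noteq> 0 \<Longrightarrow> fract_deriv (Fract p q) = Fract (pderiv p * q - p * pderiv q) (q * q)"
  by transfer simp

lemma complex_derivation_fract_deriv: "complex_derivation fract_deriv"
proof
  fix f g :: rational_function and c
  obtain p q where f: "f = Fract p q" "q \<noteq> 0" by (cases f)
  obtain r s where g: "g = Fract r s" "s \<noteq> 0" by (cases g)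
  show "fract_deriv (f + g) = fract_deriv f + fract_deriv g"
    using f g by (simp add: fract_deriv_Fract eq_fract pderiv_add pderiv_mult algebra_simps)
  show "fract_deriv (f * g) = f * fract_deriv g + g * fract_deriv f"
    using f g by (simp add: fract_deriv_Fract eq_fract pderiv_mult algebra_simps)
  show "fract_deriv (c *\<^sub>C f) = c *\<^sub>C fract_deriv f"
    using f by (simp add: scaleC_fract_def scaleC_poly_def scaleC_complex_def fract_deriv_Fract
        eq_fract pderiv_smult algebra_simps)
qed

text \<open>Compares the orders of vanishing at \<open>0\<close> of both sides, i.e. \<open>1/x\<close> has no antiderivative.\<close>

lemma no_rational_antiderivative:
  fixes p q :: "complex poly"
  assumes "q \<noteq> 0"
  shows "[:0, 1:] * (pderiv p * q - p * pderiv q) \<noteq> q * q"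
proof
  let ?X = "[:0, 1:] :: complex poly"
  assume eq: "?X * (pderiv p * q - p * pderiv q) = q * q"
  with assms have "p \<noteq> 0" by auto
  then obtain s where s: "p = ?X ^ order 0 p * s" "\<not> ?X dvd s"
    using order_decomp[of p 0] by auto
  obtain r where r: "q = ?X ^ order 0 q * r" "\<not> ?X dvd r"
    using order_decomp[of q 0] assms by auto
  define m n where "m = order 0 p" and "n = order 0 q"
  \<comment> \<open>Multiplying the derivative by \<open>?X\<close> keeps the full factor
    \<open>?X ^ k\<close>.\<close>
  have X_deriv: "?X * pderiv (?X ^ k * u) = ?X ^ k * (of_nat k * u + ?X * pderiv u)" for k u
  proof -
    have "?X * pderiv (?X ^ k) = of_nat k * ?X ^ k"
    proof (induction k)
      case (Suc k)
      have "pderiv ?X = 1"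
        by (simp add: pderiv_pCons)
      then have "?X * pderiv (?X ^ Suc k) = ?X * (?X * pderiv (?X ^ k)) + ?X * ?X ^ k"
        by (simp only: power_Suc pderiv_mult mult_1_right distrib_left)
      also have "\<dots> = of_nat (Suc k) * ?X ^ Suc k"
        by (simp only: Suc of_nat_Suc power_Suc mult_1_left algebra_simps)
      finally show ?case .
    qed simp
    moreover have "?X * pderiv (?X ^ k * u) = ?X ^ k * (?X * pderiv u) + u * (?X * pderiv (?X ^ k))"
      by (simp only: pderiv_mult algebra_simps)
    ultimately show ?thesis
      by (simp only: algebra_simps)
  qed
  \<comment> \<open>The cofactor of \<open>?X ^ (m + n)\<close> on the left-hand side; its constant
    term is \<open>m - n\<close> times those of \<open>s\<close> and \<open>r\<close>.\<close>
  define v where "v = (of_nat m - of_nat n) * (s * r) + ?X * (pderiv s * r - s * pderiv r)"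
  have "?X * (pderiv p * q - p * pderiv q) = ?X ^ m * ?X ^ n * v"
  proof -
    have "?X * (pderiv p * q - p * pderiv q) = (?X * pderiv p) * q - p * (?X * pderiv q)"
      by (simp only: algebra_simps)
    also have "\<dots> = (?X * pderiv (?X ^ m * s)) * (?X ^ n * r) - (?X ^ m * s) * (?X * pderiv (?X ^ n * r))"
      using s(1) r(1) by (simp only: m_def n_def)
    also have "\<dots> = ?X ^ m * ?X ^ n * v"
      unfolding X_deriv v_def by (simp only: algebra_simps)
    finally show ?thesis .
  qed
  then have "?X ^ m * ?X ^ n * v = ?X ^ n * ?X ^ n * (r * r)"
    using eq r(1) by (metis n_def mult.assoc mult.left_commute)
  then have v: "?X ^ m * v = ?X ^ n * (r * r)"
    by (simp add: mult.assoc mult.left_commute)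
  have "poly r 0 \<noteq> 0" "poly s 0 \<noteq> 0"
    using s(2) r(2) by (simp_all add: poly_eq_0_iff_dvd)
  then have "order 0 (r * r) = 0" and rr: "r * r \<noteq> 0"
    by (auto simp: order_0I)
  show False
  proof (cases "m = n")
    case True
    \<comment> \<open>Equal orders cancel the constant term of \<open>v\<close>, so
      \<open>?X\<close> would divide \<open>r * r\<close>.\<close>
    with v have "v = r * r" by simp
    with True have "?X * (pderiv s * r - s * pderiv r) = r * r"
      by (simp add: v_def)
    then have "poly (r * r) 0 = 0" by (metis poly_mult poly_pCons mult_zero_left add_0)
    with \<open>poly r 0 \<noteq> 0\<close> show False by simp
  next
    case False
    \<comment> \<open>Now neither \<open>v\<close> nor \<open>r * r\<close> vanishes at 0, so
      comparing orders in \<open>v\<close> forces \<open>m = n\<close>.\<close>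
    have "poly v 0 \<noteq> 0"
      using False \<open>poly r 0 \<noteq> 0\<close> \<open>poly s 0 \<noteq> 0\<close> by (simp add: v_def)
    then have "v \<noteq> 0" "order 0 v = 0" by (auto simp: order_0I)
    have "order 0 (?X ^ m * v) = m" "order 0 (?X ^ n * (r * r)) = n"
      using \<open>v \<noteq> 0\<close> rr \<open>order 0 v = 0\<close> \<open>order 0 (r * r) = 0\<close> order_power_n_n[of "0::complex"]
      by (simp_all add: order_mult)
    with v False show False by simp
  qed
qed

lemma T_Lie_neq_N_Lie_rational_function:
  "T_Lie TYPE(rational_function) \<noteq> N_Lie TYPE(rational_function)"
proof -
  interpret complex_derivation fract_deriv
    by (rule complex_derivation_fract_deriv)
  have "Fract 1 [:0, 1:] * fract_deriv (Fract [:0, 1:] 1) \<noteq> fract_deriv f" for f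
  proof (cases f)
    case (Fract p q)
    then show ?thesis
      using no_rational_antiderivative[of q p]
      by (auto simp: fract_deriv_Fract eq_fract pderiv_pCons mult.commute)
  qed
  then show ?thesis
    by (intro T_Lie_neq_N_Lie) blast
qed

theorem theorem2p7:
  "T_Lie TYPE(poly_two_vars) \<noteq> N_Lie TYPE(poly_two_vars) \<and>
   T_Lie TYPE(laurent_poly) \<noteq> N_Lie TYPE(laurent_poly) \<and>
   T_Lie TYPE(rational_function) \<noteq> N_Lie TYPE(rational_function)"
proof (intro conjI)
  \<comment> \<open>The product of the two variables has exponent \<open>(1, 1)\<close>, of weight
    0.\<close>
  show "T_Lie TYPE(poly_two_vars) \<noteq> N_Lie TYPE(poly_two_vars)"
    by (rule T_Lie_neq_N_Lie_monoid_algebra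
        [where w = "\<lambda>(i, j). of_nat i - of_nat j" and k = "(1, 0)" and l = "(0, 1)"]) auto
  show "T_Lie TYPE(laurent_poly) \<noteq> N_Lie TYPE(laurent_poly)"
    by (rule T_Lie_neq_N_Lie_monoid_algebra[where w = of_int and k = "-1" and l = 1]) auto
qed (rule T_Lie_neq_N_Lie_rational_function)

end
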